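(* Let $\mathscr{H}$ be a complex Hilbert space with inner product $[\cdot,\cdot]$ and let $T\in\mathbb{B}(\mathscr{H})$. Suppose that $S_{\mathscr{H}_0} = M_T$, where $\mathscr{H}_0$ is a finite dimensional subspace of $\mathscr{H}$, and that $\|T\|_{\mathscr{H}_0^\perp} = \sup\{\|T\zeta\| : \zeta\in\mathscr{H}_0^\perp,\ \|\zeta\| = 1\}< \|T\|$. Then for any $S\in\mathbb{B}(\mathscr{H})$ the following statements are equivalent: (i) $T\parallel S$. (ii) There exists a unit vector $\xi\in \mathscr{H}_0$ such that $|[T\xi, S\xi]| = \|T\|\,\|S\|$.
   Context: $\mathbb{B}(\mathscr{H})$ is the $C^*$-algebra of bounded operators on $\mathscr{H}$ with the operator norm. $S_{\mathscr{H}_0}=\{\xi\in\mathscr{H}_0:\|\xi\|=1\}$ is the unit sphere of $\mathscr{H}_0$, and $M_T=\{\xi\in\mathscr{H}:\|\xi\|=1,\ \|T\xi\|=\|T\|\}$ is the set of unit vectors at which $T$ attains its norm. In a normed space, $x\parallel y$ (norm-parallel) means that $\|x+\lambda y\|=\|x\|+\|y\|$ for some $\lambda\in\mathbb{T}=\{\alpha\in\mathbb{C}:|\alpha|=1\}$. *)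

theory Defs
  imports "HOL-Analysis.Analysis"
begin

text \<open>
  Complex vector spaces are real vector spaces (by restriction of scalars) with a compatible
  complex scalar multiplication, so that the real library remains available for them.
\<close>

class complex_vector = real_vector +
  fixes scaleC :: "complex \<Rightarrow> 'a \<Rightarrow> 'a"  (infixr \<open>*\<^sub>C\<close> 75)
  assumes scaleC_add_right: "a *\<^sub>C (x + y) = a *\<^sub>C x + a *\<^sub>C y"
    and scaleC_add_left: "(a + b) *\<^sub>C x = a *\<^sub>C x + b *\<^sub>C x"
    and scaleC_scaleC: "a *\<^sub>C b *\<^sub>C x = (a * b) *\<^sub>C x"
    and scaleC_one: "1 *\<^sub>C x = x"
    and scaleR_scaleC: "r *\<^sub>R x = complex_of_real r *\<^sub>C x"

global_interpretation complex_vector: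
  vector_space "scaleC :: complex \<Rightarrow> 'a \<Rightarrow> 'a::complex_vector"
  by unfold_locales (simp_all add: scaleC_add_right scaleC_add_left scaleC_scaleC scaleC_one)

class complex_normed_vector = complex_vector + real_normed_vector +
  assumes norm_scaleC: "norm (a *\<^sub>C x) = cmod a * norm x"

text \<open>The inner product is linear in the first and conjugate linear in the second argument.\<close>

class complex_inner = complex_normed_vector +
  fixes cinner :: "'a \<Rightarrow> 'a \<Rightarrow> complex"
  assumes cinner_commute: "cinner x y = cnj (cinner y x)"
    and cinner_add_left: "cinner (x + y) z = cinner x z + cinner y z"
    and cinner_scaleC_left: "cinner (a *\<^sub>C x) y = a * cinner x y"
    and cinner_self: "cinner x x = complex_of_real ((norm x)\<^sup>2)"

class complex_hilbert_space = complex_inner + complete_space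

instantiation complex :: complex_hilbert_space
begin

definition scaleC_complex :: "complex \<Rightarrow> complex \<Rightarrow> complex"
  where "scaleC_complex a x = a * x"

definition cinner_complex :: "complex \<Rightarrow> complex \<Rightarrow> complex"
  where "cinner_complex x y = x * cnj y"

instance
  by standard
    (simp_all add: scaleC_complex_def cinner_complex_def algebra_simps norm_mult
      scaleR_conv_of_real complex_norm_square del: of_real_power)

end

definition bounded_clinear ::
    "('a::complex_normed_vector \<Rightarrow> 'b::complex_normed_vector) \<Rightarrow> bool"
  where "bounded_clinear f \<longleftrightarrow> bounded_linear f \<and> (\<forall>a x. f (a *\<^sub>C x) = a *\<^sub>C f x)"

text \<open>The space of bounded complex linear operators, normed by the operator norm.\<close>

typedef (overloaded) 'a bounded_op =
    "{f :: 'a::complex_normed_vector \<Rightarrow> 'a. bounded_clinear f}"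
  morphisms app Bounded_Op
  by (rule exI[of _ "\<lambda>x. 0"]) (simp add: bounded_clinear_def)

setup_lifting type_definition_bounded_op

lemma bounded_clinear_scaleC:
  assumes "bounded_clinear f"
  shows "bounded_clinear (\<lambda>x. a *\<^sub>C f x)"
proof -
  interpret f: bounded_linear f
    using assms by (simp add: bounded_clinear_def)
  obtain K where K: "\<And>x. norm (f x) \<le> norm x * K"
    using f.bounded by blast
  have "bounded_linear (\<lambda>x. a *\<^sub>C f x)"
  proof (rule bounded_linear_intro[of _ "cmod a * K"])
    show "norm (a *\<^sub>C f x) \<le> norm x * (cmod a * K)" for x
      using mult_left_mono[OF K[of x], of "cmod a"] by (simp add: norm_scaleC mult_ac)
    show "a *\<^sub>C f (r *\<^sub>R x) = r *\<^sub>R a *\<^sub>C f x" for r x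
      unfolding f.scaleR by (simp add: scaleR_scaleC scaleC_scaleC mult.commute)
  qed (simp add: f.add scaleC_add_right)
  then show ?thesis
    using assms by (simp add: bounded_clinear_def scaleC_scaleC mult.commute)
qed

lemma onorm_scaleC:
  fixes f :: "'a::complex_normed_vector \<Rightarrow> 'a"
  assumes "bounded_clinear f"
  shows "onorm (\<lambda>x. a *\<^sub>C f x) = cmod a * onorm f"
proof -
  have f: "bounded_linear f"
    using assms by (simp add: bounded_clinear_def)
  have "onorm (\<lambda>x. a *\<^sub>C f x) = onorm (\<lambda>x. cmod a *\<^sub>R f x)"
    by (simp add: onorm_def norm_scaleC)
  also have "\<dots> = cmod a * onorm f"
    using onorm_scaleR[OF f, of "cmod a"] by simp
  finally show ?thesis .
qed

instantiation bounded_op :: (complex_normed_vector) complex_normed_vector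
begin

lift_definition zero_bounded_op :: "'a bounded_op" is "\<lambda>x. 0"
  by (simp add: bounded_clinear_def)

lift_definition plus_bounded_op :: "'a bounded_op \<Rightarrow> 'a bounded_op \<Rightarrow> 'a bounded_op"
  is "\<lambda>f g x. f x + g x"
  by (simp add: bounded_clinear_def bounded_linear_add scaleC_add_right)

lift_definition scaleC_bounded_op :: "complex \<Rightarrow> 'a bounded_op \<Rightarrow> 'a bounded_op"
  is "\<lambda>a f x. a *\<^sub>C f x"
  by (rule bounded_clinear_scaleC)

lift_definition uminus_bounded_op :: "'a bounded_op \<Rightarrow> 'a bounded_op" is "\<lambda>f x. - f x"
  by (simp add: bounded_clinear_def bounded_linear_minus)

lift_definition minus_bounded_op :: "'a bounded_op \<Rightarrow> 'a bounded_op \<Rightarrow> 'a bounded_op"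
  is "\<lambda>f g x. f x - g x"
  by (simp add: bounded_clinear_def bounded_linear_sub complex_vector.scale_right_diff_distrib)

lift_definition scaleR_bounded_op :: "real \<Rightarrow> 'a bounded_op \<Rightarrow> 'a bounded_op"
  is "\<lambda>r f x. r *\<^sub>R f x"
  unfolding scaleR_scaleC by (rule bounded_clinear_scaleC)

lift_definition norm_bounded_op :: "'a bounded_op \<Rightarrow> real" is onorm .

definition dist_bounded_op :: "'a bounded_op \<Rightarrow> 'a bounded_op \<Rightarrow> real"
  where "dist_bounded_op f g = norm (f - g)"

definition sgn_bounded_op :: "'a bounded_op \<Rightarrow> 'a bounded_op"
  where "sgn_bounded_op f = inverse (norm f) *\<^sub>R f"

definition uniformity_bounded_op :: "('a bounded_op \<times> 'a bounded_op) filter"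
  where "uniformity_bounded_op = (INF e\<in>{0<..}. principal {(f, g). dist f g < e})"

definition open_bounded_op :: "'a bounded_op set \<Rightarrow> bool"
  where "open_bounded_op U \<longleftrightarrow> (\<forall>f\<in>U. \<forall>\<^sub>F (f', g) in uniformity. f' = f \<longrightarrow> g \<in> U)"

instance
proof
  fix f g h :: "'a bounded_op" and r s :: real and a b :: complex and U :: "'a bounded_op set"
  show "dist f g = norm (f - g)"
    by (rule dist_bounded_op_def)
  show "sgn f = inverse (norm f) *\<^sub>R f"
    by (rule sgn_bounded_op_def)
  show "uniformity = (INF e\<in>{0<..}. principal {(f, g :: 'a bounded_op). dist f g < e})"
    by (rule uniformity_bounded_op_def)
  show "open U \<longleftrightarrow> (\<forall>f\<in>U. \<forall>\<^sub>F (f', g) in uniformity. f' = f \<longrightarrow> g \<in> U)"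
    by (rule open_bounded_op_def)
  show "f + g + h = f + (g + h)" "f + g = g + f" "0 + f = f" "- f + f = 0" "f - g = f + - g"
    by (transfer, simp add: fun_eq_iff add_ac)+
  show "r *\<^sub>R (f + g) = r *\<^sub>R f + r *\<^sub>R g" "(r + s) *\<^sub>R f = r *\<^sub>R f + s *\<^sub>R f"
    "r *\<^sub>R s *\<^sub>R f = (r * s) *\<^sub>R f" "1 *\<^sub>R f = f"
    by (transfer, simp add: fun_eq_iff algebra_simps)+
  show "a *\<^sub>C (f + g) = a *\<^sub>C f + a *\<^sub>C g" "(a + b) *\<^sub>C f = a *\<^sub>C f + b *\<^sub>C f"
    "a *\<^sub>C b *\<^sub>C f = (a * b) *\<^sub>C f" "1 *\<^sub>C f = f" "r *\<^sub>R f = complex_of_real r *\<^sub>C f"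
    by (transfer, simp add: fun_eq_iff scaleC_add_right scaleC_add_left scaleC_scaleC scaleC_one
        scaleR_scaleC)+
  show "norm f = 0 \<longleftrightarrow> f = 0"
    by transfer (auto simp: bounded_clinear_def onorm_eq_0 fun_eq_iff)
  show "norm (f + g) \<le> norm f + norm g"
    by transfer (simp add: bounded_clinear_def onorm_triangle)
  show "norm (r *\<^sub>R f) = \<bar>r\<bar> * norm f"
    by transfer (simp add: bounded_clinear_def onorm_scaleR)
  show "norm (a *\<^sub>C f) = cmod a * norm f"
    by transfer (rule onorm_scaleC)
qed

end

definition norm_parallel :: "'a::complex_normed_vector \<Rightarrow> 'a \<Rightarrow> bool"  (infix \<open>\<parallel>\<close> 50)
  where "x \<parallel> y \<longleftrightarrow> (\<exists>\<alpha>. cmod \<alpha> = 1 \<and> norm (x + \<alpha> *\<^sub>C y) = norm x + norm y)"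

definition finite_dim_subspace :: "'a::complex_vector set \<Rightarrow> bool"
  where "finite_dim_subspace V \<longleftrightarrow>
    complex_vector.subspace V \<and> (\<exists>B. finite B \<and> complex_vector.span B = V)"

definition unit_sphere :: "'a::complex_normed_vector set \<Rightarrow> 'a set"
  where "unit_sphere V = {x \<in> V. norm x = 1}"

definition norm_attaining :: "'a::complex_normed_vector bounded_op \<Rightarrow> 'a set"
  where "norm_attaining T = {x. norm x = 1 \<and> norm (app T x) = norm T}"

definition orth_compl :: "'a::complex_inner set \<Rightarrow> 'a set"
  where "orth_compl V = {x. \<forall>y\<in>V. cinner x y = 0}"

text \<open>
  The norm of the restriction of an operator to a subspace. Inserting 0 only matters for
  \<open>V = {0}\<close>, which has no unit vectors: the supremum is then 0, the norm of the restriction to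
  the zero space, whereas the supremum of the empty set of reals is unspecified in HOL.
\<close>

definition norm_on :: "'a::complex_normed_vector bounded_op \<Rightarrow> 'a set \<Rightarrow> real"
  where "norm_on T V = Sup (insert 0 {norm (app T x) | x. x \<in> V \<and> norm x = 1})"

end

theory Submission
  imports Defs
begin

text \<open>
  In an inner product space \<open>x \<parallel> y\<close> is the equality case of the Cauchy-Schwarz inequality,
  \<open>\<bar>[x, y]\<bar> = \<parallel>x\<parallel> \<parallel>y\<parallel>\<close>. The claim is therefore that \<open>T\<close> and \<open>S\<close> are parallel iff they have parallel
  images at some unit vector of \<open>H\<^sub>0\<close> at which both attain their norms. Such a vector clearly makes
  the operators parallel.

  For the converse let \<open>R = \<alpha> S\<close> be the rotation with \<open>\<parallel>T + R\<parallel> = \<parallel>T\<parallel> + \<parallel>R\<parallel>\<close>, and choose unit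
  vectors \<open>x\<^sub>n\<close> with \<open>\<parallel>(T + R) x\<^sub>n\<parallel> \<rightarrow> \<parallel>T\<parallel> + \<parallel>R\<parallel>\<close>; this forces \<open>\<parallel>T x\<^sub>n\<parallel> \<rightarrow> \<parallel>T\<parallel>\<close>. As \<open>T\<close> attains its
  norm throughout \<open>H\<^sub>0\<close>, it maps \<open>H\<^sub>0\<close> and its orthogonal complement to orthogonal sets
  (\<open>norm_attaining_images_orthogonal\<close>), so the gap between \<open>\<parallel>T\<parallel>\<close> and the norm of \<open>T\<close> on the
  complement makes a component of \<open>x\<^sub>n\<close> of norm \<open>r\<close> orthogonal to \<open>H\<^sub>0\<close> lower \<open>\<parallel>T x\<^sub>n\<parallel>\<^sup>2\<close> by at least
  a fixed multiple of \<open>r\<^sup>2\<close>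
  (\<open>norm_defect_bounds_orthogonal_part\<close>). Hence \<open>x\<^sub>n\<close> approaches its projection to \<open>H\<^sub>0\<close>. The
  projections lie in a compact set, because \<open>H\<^sub>0\<close> is finite dimensional, and at any limit point \<open>\<xi>\<close>
  the operator \<open>T + R\<close> attains its norm.
\<close>

section \<open>Inner products and parallel vectors\<close>

lemma cinner_add_right: "cinner x (y + z) = cinner x y + cinner (x::'a::complex_inner) z"
  by (metis cinner_add_left cinner_commute complex_cnj_add)

lemma cinner_scaleC_right: "cinner x (a *\<^sub>C y) = cnj a * cinner (x::'a::complex_inner) y"
  by (metis cinner_commute cinner_scaleC_left complex_cnj_mult)

lemma cinner_zero_left [simp]: "cinner 0 (y::'a::complex_inner) = 0"
  using cinner_add_left[of 0 0 y] by simp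

lemma cinner_zero_right [simp]: "cinner (x::'a::complex_inner) 0 = 0"
  using cinner_add_right[of x 0 0] by simp

lemma cinner_diff_left: "cinner (x - y) z = cinner x z - cinner (y::'a::complex_inner) z"
  using cinner_add_left[of "x - y" y z] by simp

lemma cinner_sum_left: "cinner (sum f A) (y::'a::complex_inner) = (\<Sum>a\<in>A. cinner (f a) y)"
  by (induction A rule: infinite_finite_induct) (simp_all add: cinner_add_left)

lemma norm_add_squared:
  fixes x y :: "'a::complex_inner"
  shows "(norm (x + y))\<^sup>2 = (norm x)\<^sup>2 + 2 * Re (cinner x y) + (norm y)\<^sup>2"
proof -
  have "complex_of_real ((norm (x + y))\<^sup>2) =
      complex_of_real ((norm x)\<^sup>2) + cinner x y + cnj (cinner x y) + complex_of_real ((norm y)\<^sup>2)"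
    by (simp only: cinner_self[symmetric] cinner_add_left cinner_add_right
        cinner_commute[of y x] add_ac)
  from arg_cong[OF this, of Re] show ?thesis by simp
qed

lemma Re_cinner_le:
  fixes x y :: "'a::complex_inner"
  shows "Re (cinner x y) \<le> norm x * norm y"
proof -
  have "(norm (x + y))\<^sup>2 \<le> (norm x + norm y)\<^sup>2"
    by (simp add: norm_triangle_ineq power_mono)
  then show ?thesis
    by (simp add: norm_add_squared power2_sum)
qed

lemma rotate_cinner_to_cmod:
  fixes x y :: "'a::complex_inner"
  obtains \<alpha> where "cmod \<alpha> = 1" "cinner x (\<alpha> *\<^sub>C y) = complex_of_real (cmod (cinner x y))"
proof (cases "cinner x y = 0")
  case True
  then show ?thesis
    by (intro that[of 1]) (simp_all add: scaleC_one)
next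
  case False
  have "cnj (sgn (cinner x y)) * cinner x y = complex_of_real (cmod (cinner x y))"
    using False complex_norm_square[of "cinner x y"]
    by (simp add: sgn_div_norm scaleR_conv_of_real field_simps power2_eq_square)
  then show ?thesis
    using False by (intro that[of "sgn (cinner x y)"]) (simp_all add: cinner_scaleC_right norm_sgn)
qed

lemma Cauchy_Schwarz:
  fixes x y :: "'a::complex_inner"
  shows "cmod (cinner x y) \<le> norm x * norm y"
proof -
  obtain \<alpha> where \<alpha>: "cmod \<alpha> = 1" "cinner x (\<alpha> *\<^sub>C y) = complex_of_real (cmod (cinner x y))"
    by (rule rotate_cinner_to_cmod)
  then show ?thesis
    using Re_cinner_le[of x "\<alpha> *\<^sub>C y"] by (simp add: norm_scaleC)
qed

text \<open>
  Expanding \<open>\<parallel>x + \<alpha> y\<parallel>\<^sup>2\<close> shows that equality in the triangle inequality means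
  \<open>Re [x, \<alpha> y] = \<parallel>x\<parallel> \<parallel>y\<parallel>\<close>. The left side is at most \<open>\<bar>[x, y]\<bar>\<close>, with equality for a suitable
  rotation \<open>\<alpha>\<close>.
\<close>

lemma parallel_iff_Cauchy_Schwarz_equality:
  fixes x y :: "'a::complex_inner"
  shows "x \<parallel> y \<longleftrightarrow> cmod (cinner x y) = norm x * norm y"
proof -
  have eq: "norm (x + \<alpha> *\<^sub>C y) = norm x + norm y \<longleftrightarrow> Re (cinner x (\<alpha> *\<^sub>C y)) = norm x * norm y"
    if "cmod \<alpha> = 1" for \<alpha>
  proof -
    have "norm (x + \<alpha> *\<^sub>C y) = norm x + norm y \<longleftrightarrow>
        (norm (x + \<alpha> *\<^sub>C y))\<^sup>2 = (norm x + norm y)\<^sup>2"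
      by (intro power2_eq_iff_nonneg[symmetric]) simp_all
    also have "\<dots> \<longleftrightarrow> Re (cinner x (\<alpha> *\<^sub>C y)) = norm x * norm y"
      using that by (auto simp: norm_add_squared power2_sum norm_scaleC)
    finally show ?thesis .
  qed
  show ?thesis
  proof
    assume "x \<parallel> y"
    then obtain \<alpha> where \<alpha>: "cmod \<alpha> = 1" "Re (cinner x (\<alpha> *\<^sub>C y)) = norm x * norm y"
      unfolding norm_parallel_def using eq by blast
    have "norm x * norm y \<le> cmod (cinner x (\<alpha> *\<^sub>C y))"
      using \<alpha>(2) complex_Re_le_cmod by metis
    also have "\<dots> = cmod (cinner x y)"
      using \<alpha>(1) by (simp add: cinner_scaleC_right norm_mult)
    finally show "cmod (cinner x y) = norm x * norm y"
      using Cauchy_Schwarz[of x y] by simp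
  next
    assume *: "cmod (cinner x y) = norm x * norm y"
    obtain \<alpha> where \<alpha>: "cmod \<alpha> = 1" "cinner x (\<alpha> *\<^sub>C y) = complex_of_real (cmod (cinner x y))"
      by (rule rotate_cinner_to_cmod)
    then show "x \<parallel> y"
      unfolding norm_parallel_def using eq[of \<alpha>] * by auto
  qed
qed

section \<open>Finite dimensional subspaces\<close>

lemma continuous_on_scaleC_left:
  fixes b :: "'a::complex_normed_vector"
  shows "continuous_on A (\<lambda>a. a *\<^sub>C b)"
proof -
  have "bounded_linear (\<lambda>a. a *\<^sub>C b)"
    by (rule bounded_linear_intro[of _ "norm b"])
      (simp_all add: scaleC_add_left norm_scaleC scaleC_scaleC scaleR_conv_of_real
        scaleR_scaleC[of _ "_ *\<^sub>C b"])
  then show ?thesis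
    by (rule linear_continuous_on)
qed

lemma compact_bounded_combinations:
  fixes B :: "'a::complex_normed_vector set"
  assumes "finite B"
  shows "compact {\<Sum>b\<in>B. c b *\<^sub>C b | c. \<forall>b\<in>B. cmod (c b) \<le> r}"
  using assms
proof (induction B)
  case empty
  then show ?case by simp
next
  case (insert b B)
  let ?K = "{\<Sum>b\<in>B. c b *\<^sub>C b | c. \<forall>b\<in>B. cmod (c b) \<le> r}"
  have "{\<Sum>b\<in>insert b B. c b *\<^sub>C b | c. \<forall>b\<in>insert b B. cmod (c b) \<le> r} =
      (\<lambda>(a, v). a *\<^sub>C b + v) ` (cball 0 r \<times> ?K)" (is "?L = ?R")
  proof (intro equalityI subsetI)
    fix x assume "x \<in> ?L"
    then obtain c where "x = c b *\<^sub>C b + (\<Sum>b\<in>B. c b *\<^sub>C b)" "\<forall>b\<in>insert b B. cmod (c b) \<le> r"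
      using insert.hyps by auto
    then show "x \<in> ?R"
      by (intro image_eqI[of _ _ "(c b, \<Sum>b\<in>B. c b *\<^sub>C b)"]) auto
  next
    fix x assume "x \<in> ?R"
    then obtain a c where ac: "x = a *\<^sub>C b + (\<Sum>b\<in>B. c b *\<^sub>C b)" "cmod a \<le> r"
        "\<forall>b\<in>B. cmod (c b) \<le> r"
      by auto
    have "(\<Sum>b\<in>B. c b *\<^sub>C b) = (\<Sum>d\<in>B. (c(b := a)) d *\<^sub>C d)"
      using insert.hyps by (intro sum.cong) auto
    then have "x = (\<Sum>d\<in>insert b B. (c(b := a)) d *\<^sub>C d)"
      using ac(1) insert.hyps by simp
    then show "x \<in> ?L"
      using ac(2,3) by (intro CollectI exI[of _ "c(b := a)"]) auto
  qed
  moreover have "continuous_on (cball 0 r \<times> ?K) (\<lambda>(a, v). a *\<^sub>C b + v)"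
    unfolding case_prod_beta
    by (intro continuous_on_add continuous_on_compose2[OF continuous_on_scaleC_left[of UNIV b]]
        continuous_on_fst continuous_on_snd continuous_on_id) auto
  ultimately show ?case
    using compact_continuous_image[OF _ compact_Times[OF compact_cball insert.IH]] by simp
qed

definition orthonormal :: "'a::complex_inner set \<Rightarrow> bool"
  where "orthonormal E \<longleftrightarrow> (\<forall>e\<in>E. norm e = 1) \<and> (\<forall>e\<in>E. \<forall>f\<in>E. e \<noteq> f \<longrightarrow> cinner e f = 0)"

definition orth_proj :: "'a::complex_inner set \<Rightarrow> 'a \<Rightarrow> 'a"
  where "orth_proj E x = (\<Sum>e\<in>E. cinner x e *\<^sub>C e)"

lemma orth_proj_in_span: "orth_proj E x \<in> complex_vector.span E"
  unfolding orth_proj_def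
  by (intro complex_vector.span_sum complex_vector.span_scale complex_vector.span_base)

lemma orth_compl_span:
  assumes "\<And>e. e \<in> E \<Longrightarrow> cinner z e = 0"
  shows "z \<in> orth_compl (complex_vector.span E)"
proof -
  have "cinner z y = 0" if "y \<in> complex_vector.span E" for y
    using that
    by (induction rule: complex_vector.span_induct_alt)
      (simp_all add: assms cinner_add_right cinner_scaleC_right)
  then show ?thesis
    by (simp add: orth_compl_def)
qed

lemma diff_orth_proj_orthogonal:
  fixes x :: "'a::complex_inner"
  assumes "finite E" "orthonormal E"
  shows "x - orth_proj E x \<in> orth_compl (complex_vector.span E)"
proof (rule orth_compl_span)
  fix f assume f: "f \<in> E"
  have "cinner (orth_proj E x) f = (\<Sum>e\<in>E. if e = f then cinner x f else 0)"
    unfolding orth_proj_def cinner_sum_left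
    using assms(2) f by (intro sum.cong) (auto simp: cinner_scaleC_left orthonormal_def cinner_self)
  then show "cinner (x - orth_proj E x) f = 0"
    using assms(1) f by (simp add: cinner_diff_left)
qed

text \<open>The Gram-Schmidt process.\<close>

lemma span_has_orthonormal_basis:
  fixes B :: "'a::complex_inner set"
  assumes "finite B"
  shows "\<exists>E. finite E \<and> orthonormal E \<and> complex_vector.span E = complex_vector.span B"
  using assms
proof (induction B)
  case empty
  then show ?case by (intro exI[of _ "{}"]) (simp add: orthonormal_def)
next
  case (insert b B)
  then obtain E where E: "finite E" "orthonormal E" "complex_vector.span E = complex_vector.span B"
    by blast
  define u where "u = b - orth_proj E b"
  have b: "b = u + orth_proj E b"
    by (simp add: u_def)
  show ?case
  proof (cases "u = 0")
    case True
    then have "b \<in> complex_vector.span B"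
      using b orth_proj_in_span[of E b] E(3) by simp
    then show ?thesis
      using E complex_vector.span_redundant by blast
  next
    case False
    define e where "e = complex_of_real (inverse (norm u)) *\<^sub>C u"
    have u: "u = complex_of_real (norm u) *\<^sub>C e"
      using False by (simp add: e_def scaleC_scaleC scaleC_one)
    have orth: "cinner e f = 0" "cinner f e = 0" if "f \<in> E" for f
    proof -
      show "cinner e f = 0"
        using diff_orth_proj_orthogonal[OF E(1,2), of b] complex_vector.span_base[OF that]
        by (simp add: e_def u_def orth_compl_def cinner_scaleC_left)
      then show "cinner f e = 0"
        using cinner_commute[of f e] by simp
    qed
    have "norm e = 1"
      using False by (simp add: e_def norm_scaleC norm_inverse)
    then have "orthonormal (insert e E)"
      using E(2) orth by (auto simp: orthonormal_def)
    moreover have "complex_vector.span (insert e E) = complex_vector.span (insert b B)"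
    proof
      have mono: "complex_vector.span B \<subseteq> complex_vector.span (insert v B)" for v :: 'a
        by (intro complex_vector.span_mono) auto
      have monoE: "complex_vector.span E \<subseteq> complex_vector.span (insert v E)" for v :: 'a
        by (intro complex_vector.span_mono) auto
      have "u \<in> complex_vector.span (insert b B)"
        unfolding u_def
      proof (rule complex_vector.span_diff)
        show "b \<in> complex_vector.span (insert b B)"
          by (simp add: complex_vector.span_base)
        show "orth_proj E b \<in> complex_vector.span (insert b B)"
          using orth_proj_in_span[of E b] E(3) mono[of b] by blast
      qed
      then have "e \<in> complex_vector.span (insert b B)"
        unfolding e_def by (rule complex_vector.span_scale)
      moreover have "E \<subseteq> complex_vector.span (insert b B)"
        using E(3) mono[of b] complex_vector.span_superset[of E] by blast
      ultimately show "complex_vector.span (insert e E) \<subseteq> complex_vector.span (insert b B)"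
        by (intro complex_vector.span_minimal complex_vector.subspace_span) simp
      have "u \<in> complex_vector.span (insert e E)"
        by (subst u) (intro complex_vector.span_scale complex_vector.span_base, simp)
      then have "b \<in> complex_vector.span (insert e E)"
        using orth_proj_in_span[of E b] monoE[of e] by (subst b) (intro complex_vector.span_add, auto)
      moreover have "B \<subseteq> complex_vector.span (insert e E)"
        using E(3) monoE[of e] complex_vector.span_superset[of B] by blast
      ultimately show "complex_vector.span (insert b B) \<subseteq> complex_vector.span (insert e E)"
        by (intro complex_vector.span_minimal complex_vector.subspace_span) simp
    qed
    ultimately show ?thesis
      using E(1) by (intro exI[of _ "insert e E"]) simp
  qed
qed

text \<open>
  The coefficients of the projection of a vector in the unit ball are bounded by 1, which puts the
  projection into a compact set of combinations of an orthonormal basis.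
\<close>

lemma finite_dim_orthogonal_decomposition:
  fixes V :: "'a::complex_inner set"
  assumes "finite_dim_subspace V"
  obtains P K where "compact K" "K \<subseteq> V" "\<And>x. P x \<in> V" "\<And>x. x - P x \<in> orth_compl V"
    "\<And>x. norm x \<le> 1 \<Longrightarrow> P x \<in> K"
proof -
  obtain B where "finite B" "complex_vector.span B = V"
    using assms by (auto simp: finite_dim_subspace_def)
  then obtain E where E: "finite E" "orthonormal E" "complex_vector.span E = V"
    using span_has_orthonormal_basis by metis
  let ?K = "{\<Sum>e\<in>E. c e *\<^sub>C e | c. \<forall>e\<in>E. cmod (c e) \<le> 1}"
  show ?thesis
  proof (rule that[of ?K "orth_proj E"])
    show "compact ?K"
      by (rule compact_bounded_combinations) fact
    show "?K \<subseteq> V"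
    proof
      fix v assume "v \<in> ?K"
      then obtain c where "v = (\<Sum>e\<in>E. c e *\<^sub>C e)"
        by blast
      then show "v \<in> V"
        unfolding E(3)[symmetric]
        by (auto intro: complex_vector.span_sum complex_vector.span_scale complex_vector.span_base)
    qed
    show "orth_proj E x \<in> V" "x - orth_proj E x \<in> orth_compl V" for x
      using orth_proj_in_span[of E x] diff_orth_proj_orthogonal[OF E(1,2), of x] E(3) by auto
    show "orth_proj E x \<in> ?K" if "norm x \<le> 1" for x
    proof -
      have "cmod (cinner x e) \<le> 1" if "e \<in> E" for e
        using Cauchy_Schwarz[of x e] that \<open>norm x \<le> 1\<close> E(2) by (simp add: orthonormal_def)
      then show ?thesis
        unfolding orth_proj_def by (intro CollectI exI[of _ "cinner x"]) simp
    qed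
  qed
qed

section \<open>Bounded operators\<close>

lemma bounded_linear_app: "bounded_linear (app T)"
  using app[of T] by (simp add: bounded_clinear_def)

lemma app_add: "app T (x + y) = app T x + app T y"
  by (rule linear_add[OF bounded_linear.linear[OF bounded_linear_app]])

lemma app_scaleC: "app T (a *\<^sub>C x) = a *\<^sub>C app T x"
  using app[of T] by (simp add: bounded_clinear_def)

lemma norm_app_le: "norm (app T x) \<le> norm T * norm x"
  unfolding norm_bounded_op.rep_eq by (rule onorm[OF bounded_linear_app])

text \<open>Transfers what is known about \<open>\<parallel>T u\<parallel>\<close> for normalized vectors \<open>u\<close> to all nonzero vectors.\<close>

lemma norm_app_unscale:
  fixes T :: "'a::complex_normed_vector bounded_op"
  assumes "\<And>u. u = complex_of_real (inverse (norm x)) *\<^sub>C x \<Longrightarrow> norm u = 1 \<Longrightarrow> P (norm (app T u))"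
    and "x \<noteq> 0"
  shows "P (norm (app T x) / norm x)"
  using assms(1)[OF refl] assms(2)
  by (simp add: norm_scaleC app_scaleC norm_inverse divide_inverse mult.commute)

lemma norm_app_gt_at_unit_vector:
  fixes T :: "'a::complex_normed_vector bounded_op"
  assumes "0 \<le> e" "e < norm T"
  obtains x where "norm x = 1" "e < norm (app T x)"
proof (rule ccontr)
  assume "\<not> thesis"
  then have *: "norm (app T u) \<le> e" if "norm u = 1" for u
    using that \<open>\<And>x. norm x = 1 \<Longrightarrow> e < norm (app T x) \<Longrightarrow> thesis\<close> by force
  have "norm (app T x) \<le> e * norm x" for x
  proof (cases "x = 0")
    case True
    then show ?thesis using norm_app_le[of T x] by simp
  next
    case False
    from norm_app_unscale[of x "\<lambda>r. r \<le> e", OF * this] False show ?thesis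
      by (simp add: divide_le_eq)
  qed
  then show False
    using onorm_bound[of e "app T"] assms by (simp add: norm_bounded_op.rep_eq)
qed

lemma bdd_above_norm_on: "bdd_above (insert 0 {norm (app T x) | x. x \<in> V \<and> norm x = 1})"
proof -
  have "norm (app T x) \<le> norm T" if "norm x = 1" for x
    using norm_app_le[of T x] that by simp
  then show ?thesis
    by (intro bdd_aboveI[of _ "norm T"]) auto
qed

lemma norm_app_le_norm_on:
  fixes T :: "'a::complex_inner bounded_op"
  assumes "x \<in> orth_compl V"
  shows "norm (app T x) \<le> norm_on T (orth_compl V) * norm x"
proof (cases "x = 0")
  case True
  then show ?thesis using norm_app_le[of T x] by simp
next
  case False
  have "norm (app T u) \<le> norm_on T (orth_compl V)"
    if "u = complex_of_real (inverse (norm x)) *\<^sub>C x" "norm u = 1" for u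
    unfolding norm_on_def
    using assms that
    by (intro cSup_upper bdd_above_norm_on) (auto simp: orth_compl_def cinner_scaleC_left)
  from norm_app_unscale[of x "\<lambda>r. r \<le> norm_on T (orth_compl V)", OF this False] False
  show ?thesis
    by (simp add: divide_le_eq)
qed

lemma norm_on_nonneg: "0 \<le> norm_on T V"
  unfolding norm_on_def by (intro cSup_upper bdd_above_norm_on) simp

lemma norm_app_on_norm_attaining_subspace:
  fixes T :: "'a::complex_normed_vector bounded_op"
  assumes "complex_vector.subspace V" "unit_sphere V \<subseteq> norm_attaining T" "x \<in> V"
  shows "norm (app T x) = norm T * norm x"
proof (cases "x = 0")
  case True
  then show ?thesis using norm_app_le[of T x] by simp
next
  case False
  have "norm (app T u) = norm T"
    if "u = complex_of_real (inverse (norm x)) *\<^sub>C x" "norm u = 1" for u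
    using assms that complex_vector.subspace_scale[OF assms(1,3)]
    by (auto simp: unit_sphere_def norm_attaining_def)
  from norm_app_unscale[of x "\<lambda>r. r = norm T", OF this False] False show ?thesis
    by (simp add: divide_eq_eq)
qed

section \<open>Approximate norm attainment near a subspace\<close>

text \<open>
  A vector \<open>y\<close> at which \<open>T\<close> attains its norm is a critical point: perturbing \<open>y\<close> by \<open>t w z\<close>, where
  \<open>z\<close> is orthogonal to \<open>y\<close>, \<open>w = [T y, T z]\<close> and \<open>t > 0\<close>, changes \<open>\<parallel>y\<parallel>\<^sup>2\<close> only to second order in \<open>t\<close>, so the first order
  change \<open>2 t \<bar>w\<bar>\<^sup>2\<close> of \<open>\<parallel>T y\<parallel>\<^sup>2\<close> has to vanish.
\<close>

lemma norm_attaining_images_orthogonal: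
  fixes T :: "'a::complex_inner bounded_op"
  assumes "norm (app T y) = norm T * norm y" "cinner y z = 0"
  shows "cinner (app T y) (app T z) = 0"
proof (rule ccontr)
  define w where "w = cinner (app T y) (app T z)"
  define k where "k = (norm T)\<^sup>2 * (norm z)\<^sup>2"
  assume "cinner (app T y) (app T z) \<noteq> 0"
  then have w: "(cmod w)\<^sup>2 > 0"
    by (simp add: w_def)
  have k: "2 \<le> t * k" if t: "t > 0" for t
  proof -
    define c where "c = complex_of_real t * w"
    have "(norm (app T (y + c *\<^sub>C z)))\<^sup>2 \<le> (norm T * norm (y + c *\<^sub>C z))\<^sup>2"
      by (intro power_mono norm_app_le) simp
    also have "\<dots> = (norm T * norm y)\<^sup>2 + (t\<^sup>2 * (cmod w)\<^sup>2) * k"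
      using assms(2) t
      by (simp add: power_mult_distrib norm_add_squared cinner_scaleC_right norm_scaleC c_def k_def
          norm_mult algebra_simps)
    finally have "(norm (app T y))\<^sup>2 + 2 * Re (cnj c * w) + (norm (c *\<^sub>C app T z))\<^sup>2
        \<le> (norm T * norm y)\<^sup>2 + (t\<^sup>2 * (cmod w)\<^sup>2) * k"
      by (simp add: app_add app_scaleC norm_add_squared cinner_scaleC_right w_def)
    moreover have "Re (cnj c * w) = t * (cmod w)\<^sup>2"
      unfolding cmod_power2 by (simp add: c_def power2_eq_square distrib_left mult_ac)
    ultimately have "2 * (t * (cmod w)\<^sup>2) \<le> (t\<^sup>2 * (cmod w)\<^sup>2) * k"
      using zero_le_power2[of "norm (c *\<^sub>C app T z)"] unfolding assms(1) by linarith
    then have "(t * (cmod w)\<^sup>2) * 2 \<le> (t * (cmod w)\<^sup>2) * (t * k)"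
      by (simp add: power2_eq_square algebra_simps)
    then show ?thesis
      using t w by (subst (asm) mult_le_cancel_left_pos) auto
  qed
  have "k \<ge> 0"
    by (simp add: k_def)
  \<comment> \<open>The inequality fails for small \<open>t\<close>; the summand 1 covers \<open>k = 0\<close>.\<close>
  have "2 \<le> 1 / (k + 1) * k"
    using \<open>k \<ge> 0\<close> by (intro k) simp
  with \<open>k \<ge> 0\<close> show False
    by (simp add: field_simps)
qed

text \<open>
  Pythagoras' theorem for \<open>y + z\<close> and, by orthogonality of the images, for \<open>T y + T z\<close>: with
  \<open>m\<close> the bound of \<open>T\<close> at \<open>z\<close>, \<open>\<parallel>T (y + z)\<parallel>\<^sup>2 \<le> \<parallel>T\<parallel>\<^sup>2 \<parallel>y\<parallel>\<^sup>2 + m\<^sup>2 \<parallel>z\<parallel>\<^sup>2\<close>.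
\<close>

lemma norm_defect_bounds_orthogonal_part:
  fixes T :: "'a::complex_inner bounded_op"
  assumes "norm (app T y) = norm T * norm y" "cinner y z = 0" "norm (app T z) \<le> m * norm z"
  shows "((norm T)\<^sup>2 - m\<^sup>2) * (norm z)\<^sup>2 \<le> (norm T * norm (y + z))\<^sup>2 - (norm (app T (y + z)))\<^sup>2"
proof -
  have "(norm (app T z))\<^sup>2 \<le> (m * norm z)\<^sup>2"
    using assms(3) by (intro power_mono) simp_all
  moreover have "(norm (app T (y + z)))\<^sup>2 = (norm T * norm y)\<^sup>2 + (norm (app T z))\<^sup>2"
    using norm_attaining_images_orthogonal[OF assms(1,2)] assms(1)
    by (simp add: app_add norm_add_squared)
  moreover have "(norm (y + z))\<^sup>2 = (norm y)\<^sup>2 + (norm z)\<^sup>2"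
    using assms(2) by (simp add: norm_add_squared)
  ultimately show ?thesis
    by (simp add: power_mult_distrib algebra_simps)
qed

lemma maximizing_sequence_accumulates_in_subspace:
  fixes T :: "'a::complex_inner bounded_op"
  assumes V: "finite_dim_subspace V" "unit_sphere V \<subseteq> norm_attaining T"
    and gap: "norm_on T (orth_compl V) < norm T"
    and x: "\<And>n. norm (x n) = 1" "(\<lambda>n. norm (app T (x n))) \<longlonglongrightarrow> norm T"
  obtains \<xi> \<sigma> where "\<xi> \<in> V" "strict_mono (\<sigma> :: nat \<Rightarrow> nat)" "(x \<circ> \<sigma>) \<longlonglongrightarrow> \<xi>"
proof -
  obtain P K where P: "compact K" "K \<subseteq> V" "\<And>x. P x \<in> V" "\<And>x. x - P x \<in> orth_compl V"
      "\<And>x. norm x \<le> 1 \<Longrightarrow> P x \<in> K"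
    using finite_dim_orthogonal_decomposition[OF V(1)] by metis
  define \<delta> where "\<delta> = (norm T)\<^sup>2 - (norm_on T (orth_compl V))\<^sup>2"
  have \<delta>: "\<delta> > 0"
    using gap norm_on_nonneg[of T "orth_compl V"] by (simp add: \<delta>_def power_strict_mono)
  have bound: "(norm (x n - P (x n)))\<^sup>2 \<le> ((norm T)\<^sup>2 - (norm (app T (x n)))\<^sup>2) / \<delta>" for n
  proof -
    have "norm (app T (P (x n))) = norm T * norm (P (x n))"
      using V P(3) unfolding finite_dim_subspace_def
      by (intro norm_app_on_norm_attaining_subspace) auto
    moreover have "cinner (P (x n)) (x n - P (x n)) = 0"
      using P(3)[of "x n"] P(4)[of "x n"] cinner_commute[of "P (x n)" "x n - P (x n)"]
      by (simp add: orth_compl_def)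
    ultimately have "\<delta> * (norm (x n - P (x n)))\<^sup>2 \<le>
        (norm T * norm (P (x n) + (x n - P (x n))))\<^sup>2 - (norm (app T (P (x n) + (x n - P (x n)))))\<^sup>2"
      unfolding \<delta>_def by (rule norm_defect_bounds_orthogonal_part[OF _ _ norm_app_le_norm_on[OF P(4)]])
    also have "\<dots> = (norm T)\<^sup>2 - (norm (app T (x n)))\<^sup>2"
      using x(1)[of n] by simp
    finally have "\<delta> * (norm (x n - P (x n)))\<^sup>2 \<le> (norm T)\<^sup>2 - (norm (app T (x n)))\<^sup>2" .
    then show ?thesis
      using \<delta> by (simp add: pos_le_divide_eq mult.commute)
  qed
  have "(\<lambda>n. ((norm T)\<^sup>2 - (norm (app T (x n)))\<^sup>2) / \<delta>) \<longlonglongrightarrow> ((norm T)\<^sup>2 - (norm T)\<^sup>2) / \<delta>"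
    using x(2) \<delta> by (intro tendsto_intros) auto
  then have lim: "(\<lambda>n. ((norm T)\<^sup>2 - (norm (app T (x n)))\<^sup>2) / \<delta>) \<longlonglongrightarrow> 0"
    by simp
  have "(\<lambda>n. (norm (x n - P (x n)))\<^sup>2) \<longlonglongrightarrow> 0"
    by (rule tendsto_sandwich[OF always_eventually always_eventually tendsto_const lim])
      (use bound in simp_all)
  then have res: "(\<lambda>n. x n - P (x n)) \<longlonglongrightarrow> 0"
    using tendsto_real_sqrt[of "\<lambda>n. (norm (x n - P (x n)))\<^sup>2" 0 sequentially]
    by (simp add: tendsto_norm_zero_iff)
  have "\<forall>n. P (x n) \<in> K"
    using P(5) x(1) by simp
  then obtain \<xi> \<sigma> where \<xi>: "\<xi> \<in> K" "strict_mono \<sigma>" "((\<lambda>n. P (x n)) \<circ> \<sigma>) \<longlonglongrightarrow> \<xi>"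
    by (rule seq_compactE[OF compact_imp_seq_compact[OF P(1)]])
  have "(\<lambda>n. (x (\<sigma> n) - P (x (\<sigma> n))) + P (x (\<sigma> n))) \<longlonglongrightarrow> 0 + \<xi>"
    using LIMSEQ_subseq_LIMSEQ[OF res \<xi>(2)] \<xi>(3) by (intro tendsto_add) (simp_all add: o_def)
  then show ?thesis
    using that[of \<xi> \<sigma>] \<xi> P(2) by (auto simp: o_def)
qed

text \<open>
  A unit vector at which \<open>T + R\<close> nearly attains the norm \<open>\<parallel>T\<parallel> + \<parallel>R\<parallel>\<close> is one at which \<open>T\<close> nearly
  attains its own norm, since \<open>R\<close> contributes at most \<open>\<parallel>R\<parallel>\<close>. So maximizing sequences for \<open>T + R\<close>
  accumulate in \<open>V\<close>.
\<close>

lemma norm_additive_attained_on_subspace: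
  fixes T R :: "'a::complex_inner bounded_op"
  assumes V: "finite_dim_subspace V" "unit_sphere V \<subseteq> norm_attaining T"
    and gap: "norm_on T (orth_compl V) < norm T"
    and eq: "norm (T + R) = norm T + norm R"
  obtains \<xi> where "\<xi> \<in> V" "norm \<xi> = 1" "norm (app (T + R) \<xi>) = norm T + norm R"
proof -
  let ?N = "norm T + norm R"
  have pos: "0 < ?N"
    using gap norm_on_nonneg[of T "orth_compl V"] norm_ge_zero[of R] by linarith
  have "\<exists>x. norm x = 1 \<and> ?N - ?N / real (Suc n) < norm (app (T + R) x)" for n
  proof -
    have "?N / real (Suc n) \<le> ?N"
      using pos by (simp add: divide_le_eq)
    moreover have "0 < ?N / real (Suc n)"
      using pos by (intro divide_pos_pos) auto
    ultimately have "0 \<le> ?N - ?N / real (Suc n)" "?N - ?N / real (Suc n) < norm (T + R)"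
      using eq by linarith+
    then show ?thesis
      using norm_app_gt_at_unit_vector by metis
  qed
  then obtain x where x: "\<And>n. norm (x n) = 1"
      "\<And>n. ?N - ?N / real (Suc n) < norm (app (T + R) (x n))"
    by metis
  have lim0: "(\<lambda>n. c - ?N / real (Suc n)) \<longlonglongrightarrow> c" for c
    using tendsto_diff[OF tendsto_const LIMSEQ_Suc[OF lim_const_over_n[of ?N]], of c] by simp
  have limTR: "(\<lambda>n. norm (app (T + R) (x n))) \<longlonglongrightarrow> ?N"
  proof (rule tendsto_sandwich[OF _ _ lim0 tendsto_const])
    show "\<forall>\<^sub>F n in sequentially. ?N - ?N / real (Suc n) \<le> norm (app (T + R) (x n))"
      using x(2) by (intro always_eventually allI less_imp_le)
    have "norm (app (T + R) (x n)) \<le> ?N" for n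
      using norm_app_le[of "T + R" "x n"] x(1)[of n] eq by simp
    then show "\<forall>\<^sub>F n in sequentially. norm (app (T + R) (x n)) \<le> ?N"
      by (intro always_eventually allI)
  qed
  have limT: "(\<lambda>n. norm (app T (x n))) \<longlonglongrightarrow> norm T"
  proof (rule tendsto_sandwich[OF _ _ lim0 tendsto_const])
    show "\<forall>\<^sub>F n in sequentially. norm T - ?N / real (Suc n) \<le> norm (app T (x n))"
    proof (intro always_eventually allI)
      fix n
      have "norm (app (T + R) (x n)) \<le> norm (app T (x n)) + norm (app R (x n))"
        by (simp add: plus_bounded_op.rep_eq norm_triangle_ineq)
      with x(2)[of n] norm_app_le[of R "x n"] x(1)[of n]
      show "norm T - ?N / real (Suc n) \<le> norm (app T (x n))"
        by simp
    qed
    have "norm (app T (x n)) \<le> norm T" for n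
      using norm_app_le[of T "x n"] x(1)[of n] by simp
    then show "\<forall>\<^sub>F n in sequentially. norm (app T (x n)) \<le> norm T"
      by (intro always_eventually allI)
  qed
  obtain \<xi> \<sigma> where \<xi>: "\<xi> \<in> V" "strict_mono (\<sigma> :: nat \<Rightarrow> nat)" "(x \<circ> \<sigma>) \<longlonglongrightarrow> \<xi>"
    using maximizing_sequence_accumulates_in_subspace[OF V gap x(1) limT] .
  have "norm \<xi> = 1"
    using tendsto_norm[OF \<xi>(3)] x(1) by (simp add: o_def LIMSEQ_const_iff)
  moreover have "norm (app (T + R) \<xi>) = ?N"
  proof (rule LIMSEQ_unique)
    show "(\<lambda>n. norm (app (T + R) (x (\<sigma> n)))) \<longlonglongrightarrow> norm (app (T + R) \<xi>)"
      using bounded_linear.tendsto[OF bounded_linear_app[of "T + R"] \<xi>(3)]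
      by (intro tendsto_norm) (simp add: o_def)
    show "(\<lambda>n. norm (app (T + R) (x (\<sigma> n)))) \<longlonglongrightarrow> ?N"
      using LIMSEQ_subseq_LIMSEQ[OF limTR \<xi>(2)] by (simp add: o_def)
  qed
  ultimately show ?thesis
    using that \<xi>(1) by blast
qed

section \<open>Parallel operators\<close>

lemma parallel_if_parallel_images:
  fixes T S :: "'a::complex_normed_vector bounded_op"
  assumes "norm \<xi> = 1" "norm (app T \<xi>) = norm T" "norm (app S \<xi>) = norm S" "app T \<xi> \<parallel> app S \<xi>"
  shows "T \<parallel> S"
proof -
  obtain \<alpha> where \<alpha>: "cmod \<alpha> = 1" "norm (app T \<xi> + \<alpha> *\<^sub>C app S \<xi>) = norm T + norm S"
    using assms by (auto simp: norm_parallel_def)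
  have "norm T + norm S \<le> norm (T + \<alpha> *\<^sub>C S)"
    using norm_app_le[of "T + \<alpha> *\<^sub>C S" \<xi>] \<alpha>(2) assms(1)
    by (simp add: plus_bounded_op.rep_eq scaleC_bounded_op.rep_eq)
  moreover have "norm (T + \<alpha> *\<^sub>C S) \<le> norm T + norm S"
    using norm_triangle_ineq[of T "\<alpha> *\<^sub>C S"] \<alpha>(1) by (simp add: norm_scaleC)
  ultimately show ?thesis
    unfolding norm_parallel_def using \<alpha>(1) by (intro exI[of _ \<alpha>]) simp
qed

theorem theorem2p18:
  fixes T S :: "'h::complex_hilbert_space bounded_op" and H\<^sub>0 :: "'h set"
  assumes "finite_dim_subspace H\<^sub>0"
    and "unit_sphere H\<^sub>0 = norm_attaining T"
    and "norm_on T (orth_compl H\<^sub>0) < norm T"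
  shows "T \<parallel> S \<longleftrightarrow>
    (\<exists>\<xi>\<in>H\<^sub>0. norm \<xi> = 1 \<and> cmod (cinner (app T \<xi>) (app S \<xi>)) = norm T * norm S)"
proof
  assume "T \<parallel> S"
  then obtain \<alpha> where \<alpha>: "cmod \<alpha> = 1" "norm (T + \<alpha> *\<^sub>C S) = norm T + norm (\<alpha> *\<^sub>C S)"
    by (auto simp: norm_parallel_def norm_scaleC)
  then obtain \<xi> where \<xi>: "\<xi> \<in> H\<^sub>0" "norm \<xi> = 1"
      "norm (app (T + \<alpha> *\<^sub>C S) \<xi>) = norm T + norm (\<alpha> *\<^sub>C S)"
    using norm_additive_attained_on_subspace[OF assms(1) equalityD1[OF assms(2)] assms(3)] by blast
  have T\<xi>: "norm (app T \<xi>) = norm T"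
    using \<xi> assms(2) by (auto simp: unit_sphere_def norm_attaining_def)
  have sum: "norm (app T \<xi> + \<alpha> *\<^sub>C app S \<xi>) = norm T + norm S"
    using \<xi>(3) \<alpha>(1) by (simp add: plus_bounded_op.rep_eq scaleC_bounded_op.rep_eq norm_scaleC)
  have S\<xi>: "norm (app S \<xi>) = norm S"
    using norm_triangle_ineq[of "app T \<xi>" "\<alpha> *\<^sub>C app S \<xi>"] sum T\<xi> \<alpha>(1) norm_app_le[of S \<xi>] \<xi>(2)
    by (simp add: norm_scaleC)
  have "app T \<xi> \<parallel> app S \<xi>"
    unfolding norm_parallel_def T\<xi> S\<xi> using \<alpha>(1) sum by blast
  then show "\<exists>\<xi>\<in>H\<^sub>0. norm \<xi> = 1 \<and> cmod (cinner (app T \<xi>) (app S \<xi>)) = norm T * norm S"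
    using \<xi> T\<xi> S\<xi> by (auto simp: parallel_iff_Cauchy_Schwarz_equality)
next
  assume "\<exists>\<xi>\<in>H\<^sub>0. norm \<xi> = 1 \<and> cmod (cinner (app T \<xi>) (app S \<xi>)) = norm T * norm S"
  then obtain \<xi> where \<xi>: "\<xi> \<in> H\<^sub>0" "norm \<xi> = 1"
      "cmod (cinner (app T \<xi>) (app S \<xi>)) = norm T * norm S"
    by blast
  have T\<xi>: "norm (app T \<xi>) = norm T"
    using \<xi> assms(2) by (auto simp: unit_sphere_def norm_attaining_def)
  have "norm T > 0"
    using assms(3) norm_on_nonneg[of T "orth_compl H\<^sub>0"] by linarith
  then have "norm S \<le> norm (app S \<xi>)"
    using Cauchy_Schwarz[of "app T \<xi>" "app S \<xi>"] \<xi>(3) T\<xi> by simp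
  then have S\<xi>: "norm (app S \<xi>) = norm S"
    using norm_app_le[of S \<xi>] \<xi>(2) by simp
  have "app T \<xi> \<parallel> app S \<xi>"
    using \<xi>(3) T\<xi> S\<xi> by (simp add: parallel_iff_Cauchy_Schwarz_equality)
  then show "T \<parallel> S"
    using parallel_if_parallel_images \<xi>(2) T\<xi> S\<xi> by blast
qed

end
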